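(* Let $n\ge 2$ and let $P(z)=z+a_2 z^2+\ldots+a_{n-1}z^{n-1}+a_n z^n$ be a complex polynomial which is univalent (one-to-one) in the unit disk $\mathbb{D}=\{z\in\mathbb{C}:|z|<1\}$ and which has all of its critical points on the unit circle, that is, $|a_n|=\frac1n$. Then the following statements are equivalent: (a) $P'$ has positive real part in $\mathbb{D}$, i.e. $\mathrm{Re}\,P'(z)>0$ for all $z\in\mathbb{D}$; (b) $a_2=\ldots=a_{n-1}=0$; (c) $P$ is starlike.
   Context: The critical points of $P$ are the zeros in $\mathbb{C}$ of the derivative $P'$. A set $E\subset\mathbb{C}$ is starlike with respect to the origin if for every $z\in E$ the segment $[0,z]$ is contained in $E$. A function $f$ analytic in $\mathbb{D}$ is called starlike if it maps $\mathbb{D}$ univalently (one-to-one) onto a domain that is starlike with respect to the origin. For $n=2$ condition (b) is vacuous. For a polynomial $P$ of the given form that is univalent in $\mathbb{D}$ with $a_n\neq 0$, having all critical points on the unit circle is equivalent to $|a_n|=\frac1n$; the hypothesis may be taken as $|a_n|=\frac1n$. *)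

theory Defs
  imports "HOL-Complex_Analysis.Complex_Analysis" "HOL-Computational_Algebra.Polynomial"
begin

definition critical_points :: "complex poly \<Rightarrow> complex set" where
  "critical_points P = {z. poly (pderiv P) z = 0}"

(* Unlike the library's starlike, the centre is fixed to be the origin. *)
definition starlike_wrt_origin :: "complex set \<Rightarrow> bool" where
  "starlike_wrt_origin E \<longleftrightarrow> (\<forall>z\<in>E. closed_segment 0 z \<subseteq> E)"

(* A domain is a nonempty, open, connected set; nonemptiness of an image of the disk is immediate. *)
definition starlike_function :: "(complex \<Rightarrow> complex) \<Rightarrow> bool" where
  "starlike_function f \<longleftrightarrow>
     f analytic_on ball 0 1 \<and> inj_on f (ball 0 1) \<and>
     open (f ` ball 0 1) \<and> connected (f ` ball 0 1) \<and>
     starlike_wrt_origin (f ` ball 0 1)"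

end

theory Submission
  imports Defs "HOL-Computational_Algebra.Fundamental_Theorem_Algebra"
begin

text \<open>
  Put \<open>p = P'\<close>, \<open>q = P/z\<close>, \<open>N = n - 1\<close> and let \<open>c\<close> be the leading coefficient of \<open>p\<close>. As all zeros of \<open>p\<close>
  lie on the unit circle, \<open>p\<close> is self-inversive: \<open>p = c p*\<close> with \<open>|c| = 1\<close>, where \<open>p*(z) = z^N cnj (p z)\<close>
  on the circle. Condition (a) says \<open>Re (p cnj 1) \<ge> 0\<close> in the disk, and (c) amounts to
  \<open>Re (p cnj q) \<ge> 0\<close>: by the Schwarz lemma \<open>|P\<^sup>-\<^sup>1 (t P(z))| \<le> |z|\<close> for \<open>t \<le> 1\<close>, and one differentiates at
  \<open>t = 1\<close>; conversely the inequality makes \<open>|P\<^sup>-\<^sup>1 (t w)|\<close> increasing in \<open>t\<close>.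

  If \<open>Re (p cnj r) \<ge> 0\<close> in the disk and \<open>r \<noteq> 0\<close> at the zeros of \<open>p\<close>, then looking at \<open>p cnj r\<close> in the
  half-disk near a zero \<open>z\<close> of \<open>p\<close> shows that \<open>z\<close> is simple and \<open>z p'(z) cnj (r z)\<close> is real. Together with
  the self-inversivity this gives that \<open>r + c r*\<close> vanishes at all \<open>N\<close> zeros of \<open>p\<close>, so it is a
  multiple of \<open>p\<close>. For \<open>r = 1\<close> and for \<open>r = q\<close>, comparing coefficients yields (b).
\<close>

section \<open>Self-inversive polynomials\<close>

text \<open>This is \<open>p*\<close> relative to a nominal degree \<open>N\<close>. Reflection at
  the actual degree, as in \<open>reflect_poly\<close>, would not suit the later use with
  \<open>q = 1\<close>, where \<open>1*\<close> must be \<open>z^N\<close>.\<close>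

definition conj_reciprocal :: "nat \<Rightarrow> complex poly \<Rightarrow> complex poly" where
  "conj_reciprocal N q = (\<Sum>k\<le>N. monom (cnj (coeff q (N - k))) k)"

lemma coeff_conj_reciprocal:
  "coeff (conj_reciprocal N q) k = (if k \<le> N then cnj (coeff q (N - k)) else 0)"
  by (simp add: conj_reciprocal_def coeff_sum)

lemma poly_conj_reciprocal:
  assumes "degree q \<le> N" "norm z = 1"
  shows "poly (conj_reciprocal N q) z = z ^ N * cnj (poly q z)"
proof -
  have zz: "z * cnj z = 1"
    using assms(2) by (simp add: complex_norm_square[symmetric])
  have pow: "z ^ (N - k) = z ^ N * cnj z ^ k" if "k \<le> N" for k
  proof -
    have "z ^ N * cnj z ^ k = z ^ (N - k) * (z * cnj z) ^ k"
      using that by (simp add: power_mult_distrib power_add[symmetric] mult.assoc[symmetric])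
    then show ?thesis by (simp add: zz)
  qed
  have q: "poly q z = (\<Sum>k\<le>N. coeff q k * z ^ k)"
    unfolding poly_altdef
    by (rule sum.mono_neutral_left) (use assms(1) in \<open>auto intro: le_degree simp: coeff_eq_0\<close>)
  have "poly (conj_reciprocal N q) z = (\<Sum>k\<le>N. cnj (coeff q (N - k)) * z ^ k)"
    by (simp add: conj_reciprocal_def poly_sum poly_monom)
  also have "\<dots> = (\<Sum>k\<le>N. cnj (coeff q k) * z ^ (N - k))"
    by (rule sum.reindex_bij_witness[of _ "\<lambda>k. N - k" "\<lambda>k. N - k"]) auto
  also have "\<dots> = z ^ N * cnj (poly q z)"
    unfolding q by (auto simp: sum_distrib_left pow mult_ac intro!: sum.cong)
  finally show ?thesis .
qed

text \<open>Reflection is multiplicative, so linear factors can be split off one at a time; for |a|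
  = 1 the reflected factor is 1 - cnj a * z = - cnj a * (z - a).\<close>

lemma reflect_poly_cnj_roots_on_sphere:
  fixes p :: "complex poly"
  assumes "p \<noteq> 0" "\<And>z. poly p z = 0 \<Longrightarrow> norm z = 1"
  shows "\<exists>c. reflect_poly (map_poly cnj p) = smult c p"
  using assms
proof (induction "degree p" arbitrary: p)
  case 0
  then obtain a where "p = [:a:]" "a \<noteq> 0"
    using degree_eq_zeroE by (metis pCons_0_0)
  then have "reflect_poly (map_poly cnj p) = smult (cnj a / a) p"
    by (simp add: map_poly_pCons)
  then show ?case ..
next
  case (Suc d)
  then obtain a where a: "poly p a = 0"
    using fundamental_theorem_of_algebra_alt[of p] by fastforce
  then obtain r where r: "p = [:- a, 1:] * r"
    by (auto simp: poly_eq_0_iff_dvd)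
  have "r \<noteq> 0" using Suc.prems r by auto
  then have "degree p = Suc (degree r)"
    unfolding r by (subst degree_mult_eq) auto
  then have "d = degree r" using Suc.hyps by simp
  then obtain c where c: "reflect_poly (map_poly cnj r) = smult c r"
    using Suc.hyps(1)[of r] \<open>r \<noteq> 0\<close> Suc.prems(2) r by auto
  have aa: "a * cnj a = 1"
    using Suc.prems(2)[OF a] by (simp add: complex_norm_square[symmetric])
  then have [simp]: "a \<noteq> 0" by auto
  have m: "map_poly cnj p = map_poly cnj [:- a, 1:] * map_poly cnj r"
    by (simp add: r poly_eq_poly_eq_iff[symmetric] fun_eq_iff map_poly_pCons)
  have "reflect_poly (map_poly cnj [:- a, 1:]) = smult (- cnj a) [:- a, 1:]"
    using aa by (simp add: map_poly_pCons reflect_poly_pCons mult.commute)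
  then have "reflect_poly (map_poly cnj p) = smult (c * - cnj a) p"
    unfolding m reflect_poly_mult c by (simp only: r mult_smult_left mult_smult_right smult_smult)
  then show ?case ..
qed

lemma self_inversive:
  fixes p :: "complex poly"
  assumes "coeff p 0 = 1" "\<And>z. poly p z = 0 \<Longrightarrow> norm z = 1"
  defines "c \<equiv> lead_coeff p"
  shows "norm c = 1" "p = smult c (conj_reciprocal (degree p) p)"
proof -
  have "p \<noteq> 0" using assms(1) by auto
  then obtain d where d: "reflect_poly (map_poly cnj p) = smult d p"
    using reflect_poly_cnj_roots_on_sphere assms(2) by blast
  have deg: "degree (map_poly cnj p) = degree p"
    by (rule degree_map_poly) auto
  have co: "d * coeff p k = cnj (coeff p (degree p - k))" if "k \<le> degree p" for k
    using arg_cong[OF d, of "\<lambda>r. coeff r k"] that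
    by (simp add: coeff_reflect_poly deg coeff_map_poly)
  \<comment> \<open>The constant coefficient identifies the factor \<open>d\<close>; the top
    coefficient then gives |c| = 1.\<close>
  have dc: "d = cnj c" using co[of 0] assms(1) by (simp add: c_def)
  have "cnj c * c = 1"
    using co[of "degree p"] assms(1) by (simp add: dc c_def)
  then have cc: "c * cnj c = 1" by (simp add: mult.commute)
  then have "(norm c)\<^sup>2 = 1"
    by (metis complex_norm_square of_real_eq_1_iff)
  then show "norm c = 1" using norm_ge_zero[of c] by (auto simp: power2_eq_1_iff)
  show "p = smult c (conj_reciprocal (degree p) p)"
  proof (rule poly_eqI)
    fix k
    show "coeff p k = coeff (smult c (conj_reciprocal (degree p) p)) k"
    proof (cases "k \<le> degree p")
      case True
      then have "c * cnj (coeff p (degree p - k)) = c * cnj c * coeff p k"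
        by (simp add: co[symmetric] dc)
      then show ?thesis using True by (simp add: coeff_conj_reciprocal cc)
    qed (simp add: coeff_conj_reciprocal coeff_eq_0)
  qed
qed

section \<open>Boundary zeros under a sign condition\<close>

lemma half_plane_power:
  fixes K :: complex
  assumes "m \<ge> 2" "\<And>d. Re d > 0 \<Longrightarrow> Re (K * d ^ m) \<ge> 0"
  shows "K = 0"
proof -
  \<comment> \<open>For \<open>m \<ge> 2\<close> the values \<open>d ^ m\<close> include the three cube roots of unity, whose sum vanishes.\<close>
  define \<alpha> where "\<alpha> = 2 * pi / (3 * real m)"
  have "0 < \<alpha>" "\<alpha> < pi / 2"
    using assms(1) by (auto simp: \<alpha>_def field_simps)
  then have "Re (cis \<alpha>) > 0" "Re (cis (- \<alpha>)) > 0"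
    by (auto intro: cos_gt_zero_pi)
  moreover have "cis \<alpha> ^ m = cis (2 * pi / 3)" "cis (- \<alpha>) ^ m = cis (- (2 * pi / 3))"
    using assms(1) by (auto simp: Complex.DeMoivre \<alpha>_def)
  ultimately have "Re (K * cis (2 * pi / 3)) \<ge> 0" "Re (K * cis (- (2 * pi / 3))) \<ge> 0"
    using assms(2) by metis+
  moreover have "Re K \<ge> 0" using assms(2)[of 1] by simp
  moreover have "cos (2 * pi / 3) = - 1 / 2" "sin (2 * pi / 3) = sqrt 3 / 2"
    using cos_120 sin_120 by auto
  ultimately have "Re K \<ge> 0" "- Re K / 2 - Im K * sqrt 3 / 2 \<ge> 0" "- Re K / 2 + Im K * sqrt 3 / 2 \<ge> 0"
    by simp_all
  then have "Re K = 0" "Im K * sqrt 3 = 0" by linarith+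
  then show ?thesis by (auto simp: complex_eq_iff)
qed

lemma half_plane_linear:
  fixes K :: complex
  assumes "\<And>d. Re d > 0 \<Longrightarrow> Re (K * d) \<ge> 0"
  shows "Im K = 0"
proof (rule ccontr)
  assume "Im K \<noteq> 0"
  \<comment> \<open>The imaginary part of the witness is solved from Re (K * d) = -1.\<close>
  then have "Re (K * Complex 1 ((Re K + 1) / Im K)) = - 1" by simp
  then show False using assms[of "Complex 1 ((Re K + 1) / Im K)"] by simp
qed

lemma Re_of_real_mult: "Re (of_real r * z) = r * Re z"
  by simp

text \<open>Approaching \<open>z0\<close> from inside along z0 * (1 - \<epsilon> * d), with Re d >
  0, the product p * cnj q behaves like \<epsilon>^m * K * d^m, where m is the order of the zero. So
  Re (K * d^m) >= 0 on the whole half-plane, which excludes m >= 2 and makes K real for m =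
  1.\<close>

lemma boundary_zero:
  fixes p q :: "complex poly"
  assumes nonneg: "\<forall>z\<in>ball 0 1. Re (poly p z * cnj (poly q z)) \<ge> 0"
    and "norm z0 = 1" "p \<noteq> 0" "poly p z0 = 0" "poly q z0 \<noteq> 0"
  shows "poly (pderiv p) z0 \<noteq> 0" "Im (z0 * poly (pderiv p) z0 * cnj (poly q z0)) = 0"
proof -
  define m where "m = order z0 p"
  obtain s where s: "p = [:- z0, 1:] ^ m * s" "\<not> [:- z0, 1:] dvd s"
    using order_decomp[OF \<open>p \<noteq> 0\<close>] m_def by blast
  then have s0: "poly s z0 \<noteq> 0" by (simp add: poly_eq_0_iff_dvd)
  define K where "K = (- z0) ^ m * poly s z0 * cnj (poly q z0)"
  have z0: "z0 \<noteq> 0" using assms(2) by auto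
  have "K \<noteq> 0" using s0 assms z0 by (simp add: K_def)
  have K: "Re (K * d ^ m) \<ge> 0" if d: "Re d > 0" for d
  proof -
    define \<zeta> where "\<zeta> \<epsilon> = z0 * (1 - of_real \<epsilon> * d)" for \<epsilon> :: real
    define G where "G \<epsilon> = Re ((- z0) ^ m * poly s (\<zeta> \<epsilon>) * cnj (poly q (\<zeta> \<epsilon>)) * d ^ m)" for \<epsilon>
    \<comment> \<open>For \<epsilon> > 0 the upper bound says exactly that |1 - \<epsilon> * d| <
      1.\<close>
    have "G \<epsilon> \<ge> 0" if \<epsilon>: "0 < \<epsilon>" "\<epsilon> < 2 * Re d / (norm d)\<^sup>2" for \<epsilon>
    proof -
      have "d \<noteq> 0" using d by auto
      have "(norm (1 - of_real \<epsilon> * d))\<^sup>2 = 1 - \<epsilon> * (2 * Re d - \<epsilon> * (norm d)\<^sup>2)"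
        by (simp only: cmod_power2) (simp add: power2_eq_square algebra_simps)
      also have "\<dots> < 1"
        using \<epsilon> \<open>d \<noteq> 0\<close> by (simp add: field_simps)
      finally have "norm (\<zeta> \<epsilon>) < 1"
        using assms(2) by (simp add: \<zeta>_def norm_mult power_less_one_iff)
      then have "0 \<le> Re (poly p (\<zeta> \<epsilon>) * cnj (poly q (\<zeta> \<epsilon>)))" using nonneg by simp
      also have "poly p (\<zeta> \<epsilon>) = of_real (\<epsilon> ^ m) * ((- z0) ^ m * d ^ m * poly s (\<zeta> \<epsilon>))"
        by (simp add: s(1) \<zeta>_def poly_power algebra_simps flip: power_mult_distrib)
      also have "Re (\<dots> * cnj (poly q (\<zeta> \<epsilon>))) = \<epsilon> ^ m * G \<epsilon>"
        unfolding G_def mult.assoc Re_of_real_mult by (simp only: mult_ac)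
      finally show ?thesis using zero_less_power[OF \<epsilon>(1), of m] by (simp add: zero_le_mult_iff)
    qed
    moreover have "2 * Re d / (norm d)\<^sup>2 > 0" using d by (intro divide_pos_pos) auto
    ultimately have "eventually (\<lambda>\<epsilon>. G \<epsilon> \<ge> 0) (at_right 0)"
      unfolding eventually_at_right_field by blast
    moreover have "continuous_on UNIV G"
      unfolding G_def \<zeta>_def by (intro continuous_intros)
    then have "isCont G 0" by (simp add: continuous_on_eq_continuous_at)
    then have "(G \<longlongrightarrow> G 0) (at_right 0)"
      by (simp add: isCont_def filterlim_at_split)
    ultimately have "G 0 \<ge> 0"
      by (intro tendsto_lowerbound[of G "G 0"]) auto
    then show ?thesis by (simp add: G_def \<zeta>_def K_def)
  qed
  have "m \<noteq> 0" using assms(3,4) by (simp add: m_def order_root)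
  moreover have "\<not> m \<ge> 2" using half_plane_power[OF _ K] \<open>K \<noteq> 0\<close> by blast
  ultimately have "m = 1" by simp
  \<comment> \<open>For a simple zero, K = - z0 * p'(z0) * cnj (q z0).\<close>
  then have "poly (pderiv p) z0 = poly s z0"
    by (simp add: s(1) pderiv_mult pderiv_pCons del: mult_pCons_left)
  moreover have "Im K = 0" using half_plane_linear[of K] K \<open>m = 1\<close> by simp
  ultimately show "poly (pderiv p) z0 \<noteq> 0" "Im (z0 * poly (pderiv p) z0 * cnj (poly q z0)) = 0"
    using s0 \<open>m = 1\<close> by (simp_all add: K_def)
qed

text \<open>Subtracting the multiple of \<open>p\<close> that cancels the coefficient at
  \<open>degree p\<close> leaves a polynomial of smaller degree that still vanishes at the
  \<open>degree p\<close> distinct roots of \<open>p\<close>.\<close>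

lemma poly_eq_smult_if_roots:
  fixes p r :: "complex poly"
  assumes "rsquarefree p" "degree r \<le> degree p" "\<And>z. poly p z = 0 \<Longrightarrow> poly r z = 0"
  shows "\<exists>l. r = smult l p"
proof -
  have "p \<noteq> 0" using assms(1) by (simp add: rsquarefree_def)
  have "degree p = degree (\<Prod>z | poly p z = 0. [:- z, 1:])"
    using \<open>p \<noteq> 0\<close>
    by (subst complex_poly_decompose_rsquarefree[OF assms(1), symmetric]) simp
  also have "\<dots> = card {z. poly p z = 0}"
    by (subst degree_prod_eq_sum_degree) auto
  finally have card: "card {z. poly p z = 0} = degree p" by simp
  define l where "l = coeff r (degree p) / lead_coeff p"
  define s where "s = r - smult l p"
  have "s = 0"
  proof (rule ccontr)
    assume "s \<noteq> 0"
    have "degree s \<le> degree p"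
      unfolding s_def using assms(2) degree_smult_le by (intro degree_diff_le) auto
    moreover have "coeff s (degree p) = 0"
      using \<open>p \<noteq> 0\<close> by (simp add: s_def l_def)
    ultimately have "degree s < degree p"
      using \<open>s \<noteq> 0\<close> by (metis le_neq_implies_less leading_coeff_0_iff)
    moreover have "card {z. poly p z = 0} \<le> card {z. poly s z = 0}"
      using \<open>s \<noteq> 0\<close> assms(3) by (intro card_mono poly_roots_finite) (auto simp: s_def)
    ultimately show False
      using card card_poly_roots_bound[OF \<open>s \<noteq> 0\<close>] by simp
  qed
  then show ?thesis by (auto simp: s_def)
qed

lemma self_inversive_proportional:
  fixes p q :: "complex poly"
  defines "N \<equiv> degree p"
  assumes "p \<noteq> 0" and self: "p = smult c (conj_reciprocal N p)"
    and roots: "\<And>z. poly p z = 0 \<Longrightarrow> norm z = 1 \<and> poly q z \<noteq> 0"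
    and "degree q \<le> N"
    and nonneg: "\<forall>z\<in>ball 0 1. Re (poly p z * cnj (poly q z)) \<ge> 0"
  shows "\<exists>l. q + smult c (conj_reciprocal N q) = smult l p"
proof (rule poly_eq_smult_if_roots)
  note zero = boundary_zero[OF nonneg _ \<open>p \<noteq> 0\<close>]
  show "rsquarefree p"
    unfolding rsquarefree_roots using zero(1) roots by blast
  have "degree (conj_reciprocal N q) \<le> N"
    by (rule degree_le) (simp add: coeff_conj_reciprocal)
  then show "degree (q + smult c (conj_reciprocal N q)) \<le> degree p"
    using \<open>degree q \<le> N\<close> degree_smult_le[of c "conj_reciprocal N q"]
    by (intro degree_add_le) (auto simp: N_def)
  fix z assume z: "poly p z = 0"
  then have nz: "norm z = 1" "poly q z \<noteq> 0" using roots by auto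
  define w where "w = z * poly (pderiv p) z"
  have "w \<noteq> 0" using zero(1)[OF nz(1) z nz(2)] nz(1) by (auto simp: w_def)
  have "w * cnj (poly q z) = cnj (w * cnj (poly q z))"
    using zero(2)[OF nz(1) z nz(2), folded w_def] by (simp add: complex_eq_iff)
  then have real: "w * cnj (poly q z) = cnj w * poly q z" by simp
  \<comment> \<open>\<open>e\<close> is z * p'(z). Reflection turns the weight k into N - k, so c e*
    = N p - e; evaluating at a zero of \<open>p\<close> gives the relation for
    \<open>w\<close>.\<close>
  define e where "e = pCons 0 (pderiv p)"
  have e: "coeff e k = of_nat k * coeff p k" for k
    by (cases k) (simp_all add: e_def coeff_pderiv)
  have "degree e \<le> N"
    by (rule degree_le) (simp add: e N_def coeff_eq_0)
  have "smult c (conj_reciprocal N e) = smult (of_nat N) p - e"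
  proof (rule poly_eqI)
    fix k
    show "coeff (smult c (conj_reciprocal N e)) k = coeff (smult (of_nat N) p - e) k"
    proof (cases "k \<le> N")
      case True
      have "coeff p k = c * cnj (coeff p (N - k))"
        using arg_cong[OF self, of "\<lambda>r. coeff r k"] True by (simp add: coeff_conj_reciprocal)
      then show ?thesis using True
        by (simp add: coeff_conj_reciprocal e of_nat_diff algebra_simps)
    qed (simp add: coeff_conj_reciprocal e N_def coeff_eq_0)
  qed
  then have "poly (smult c (conj_reciprocal N e)) z = poly (smult (of_nat N) p - e) z" by simp
  then have w: "c * (z ^ N * cnj w) = - w"
    using \<open>degree e \<le> N\<close> nz(1) z by (simp add: poly_conj_reciprocal e_def w_def)
  have "cnj w * poly (q + smult c (conj_reciprocal N q)) z
      = cnj w * poly q z + c * (z ^ N * cnj w) * cnj (poly q z)"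
    using \<open>degree q \<le> N\<close> nz(1) by (simp add: poly_conj_reciprocal algebra_simps)
  also have "\<dots> = 0" unfolding w using real by simp
  finally show "poly (q + smult c (conj_reciprocal N q)) z = 0"
    using \<open>w \<noteq> 0\<close> by simp
qed

section \<open>Starlikeness as a sign condition\<close>

text \<open>Both directions of the starlikeness criterion follow the modulus of the preimage of a
  point moving on a ray; this is the chain rule with g' = 1 / f'.\<close>

lemma has_real_derivative_norm_inverse_on_ray:
  assumes f: "f holomorphic_on S" "open S" "inj_on f S"
    and g: "g holomorphic_on f ` S" "\<And>z. z \<in> S \<Longrightarrow> deriv f z * deriv g (f z) = 1"
      "\<And>z. z \<in> S \<Longrightarrow> g (f z) = z"
    and w: "w \<in> S" "f w = of_real t * \<zeta>"
  shows "((\<lambda>t. (norm (g (of_real t * \<zeta>)))\<^sup>2) has_real_derivative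
           2 * Re (cnj w * \<zeta> / deriv f w)) (at t)"
proof -
  have "open (f ` S)" using f by (rule open_mapping_thm3)
  then have "(g has_field_derivative deriv g (f w)) (at (of_real t * \<zeta>))"
    using holomorphic_derivI[OF g(1), of "f w" UNIV] imageI[OF w(1), of f] w(2) by simp
  moreover have "((\<lambda>t. of_real t * \<zeta>) has_vector_derivative \<zeta>) (at t)"
    by (auto intro!: derivative_eq_intros)
  ultimately have h: "((\<lambda>t. g (of_real t * \<zeta>)) has_vector_derivative \<zeta> * deriv g (f w)) (at t)"
    using field_vector_diff_chain_at[of "\<lambda>t. of_real t * \<zeta>" \<zeta> t g] by (simp add: o_def)
  have "g (of_real t * \<zeta>) = w" using g(3) w by metis
  moreover have "deriv g (f w) = 1 / deriv f w"
    using g(2)[OF w(1)] by (auto simp: divide_simps mult.commute)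
  ultimately have "((\<lambda>t. (norm (g (of_real t * \<zeta>)))\<^sup>2) has_vector_derivative
      2 * (w \<bullet> (\<zeta> / deriv f w))) (at t)"
    using bounded_bilinear.has_vector_derivative[OF bounded_bilinear_inner h h]
    by (simp add: power2_norm_eq_inner inner_commute)
  moreover have "w \<bullet> v = Re (cnj w * v)" for v
    by (simp add: inner_complex_def)
  ultimately show ?thesis
    by (simp add: has_real_derivative_iff_has_vector_derivative)
qed

text \<open>After conjugation the two expressions differ by the factor |v|^2. This converts the
  derivative on the ray into its division-free form.\<close>

lemma Re_mult_cnj_nonneg_iff:
  fixes z u v :: complex
  assumes "v \<noteq> 0"
  shows "Re (cnj z * u / v) \<ge> 0 \<longleftrightarrow> Re (v * cnj u * z) \<ge> 0"
proof -
  have "Re (v * cnj u * z) = Re (cnj (v * cnj u * z))" by (simp only: cnj.simps)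
  also have "cnj (v * cnj u * z) = of_real ((norm v)\<^sup>2) * (cnj z * u / v)"
    unfolding complex_norm_square using assms by (simp add: field_simps)
  also have "Re \<dots> = (norm v)\<^sup>2 * Re (cnj z * u / v)" by (simp only: Re_of_real_mult)
  finally show ?thesis using assms by (simp add: zero_le_mult_iff)
qed

lemma starlike_imp_Re_nonneg:
  assumes f: "f holomorphic_on ball 0 1" "inj_on f (ball 0 1)" "f 0 = 0"
    and star: "starlike_wrt_origin (f ` ball 0 1)" and z: "norm z < 1"
  shows "Re (deriv f z * cnj (f z) * z) \<ge> 0"
proof -
  obtain g where g: "g holomorphic_on f ` ball 0 1"
      "\<And>z. z \<in> ball 0 1 \<Longrightarrow> deriv f z * deriv g (f z) = 1"
      "\<And>z. z \<in> ball 0 1 \<Longrightarrow> g (f z) = z"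
    using holomorphic_has_inverse[OF f(1) open_ball f(2)] by metis
  have ray: "of_real t * f u \<in> f ` ball 0 1" if "0 \<le> t" "t \<le> 1" "norm u < 1" for t u
  proof -
    have "of_real t * f u \<in> closed_segment 0 (f u)"
      using that by (auto simp: in_segment scaleR_conv_of_real)
    then show ?thesis using star that by (auto simp: starlike_wrt_origin_def)
  qed
  define \<phi> where "\<phi> t = (norm (g (of_real t * f z)))\<^sup>2" for t
  have le: "\<phi> t \<le> \<phi> 1" if t: "0 \<le> t" "t \<le> 1" for t
  proof -
    \<comment> \<open>Starlikeness makes \<open>h\<close> a self-map of the disk fixing 0, so the
      Schwarz lemma applies.\<close>
    define h where "h u = g (of_real t * f u)" for u
    have "h holomorphic_on ball 0 1"
      unfolding h_def
      by (rule holomorphic_on_compose_gen[OF _ g(1), unfolded o_def])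
        (use f(1) ray t in \<open>auto intro!: holomorphic_intros\<close>)
    moreover have "h 0 = 0" using g(3)[of 0] f(3) by (simp add: h_def)
    moreover have "norm (h u) < 1" if "norm u < 1" for u
      using ray[OF t that] g(3) by (force simp: h_def)
    ultimately have "norm (h z) \<le> norm z"
      using Schwarz_Lemma(1) z by blast
    then show ?thesis using g(3)[of z] z by (simp add: \<phi>_def h_def)
  qed
  have der: "(\<phi> has_real_derivative 2 * Re (cnj z * f z / deriv f z)) (at 1)"
    unfolding \<phi>_def
    by (rule has_real_derivative_norm_inverse_on_ray[OF f(1) open_ball f(2) g]) (use z in auto)
  have "Re (cnj z * f z / deriv f z) \<ge> 0"
  proof (rule ccontr)
    assume "\<not> ?thesis"
    then obtain d where d: "d > 0" "\<And>h. h > 0 \<Longrightarrow> h < d \<Longrightarrow> \<phi> 1 < \<phi> (1 - h)"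
      using DERIV_neg_dec_left[OF der] by auto
    \<comment> \<open>The cap at 1 keeps the parameter in [0, 1], where \<open>le\<close>
      applies.\<close>
    then have "\<phi> 1 < \<phi> (1 - min (d / 2) 1)" by simp
    then show False using le[of "1 - min (d / 2) 1"] d(1) by simp
  qed
  moreover have "deriv f z \<noteq> 0" using g(2)[of z] z by auto
  ultimately show ?thesis using Re_mult_cnj_nonneg_iff by blast
qed

text \<open>Let m be the last parameter at which the segment to f z leaves the image. On (m, 1] the
  preimage modulus is nondecreasing, so it stays at most |z|; the segment there lies in the compact
  image of \<open>cball 0 (norm z)\<close>, which therefore also contains the point at m.\<close>

lemma Re_nonneg_imp_starlike:
  assumes f: "f holomorphic_on ball 0 1" "inj_on f (ball 0 1)" "f 0 = 0"
    and nonneg: "\<And>z. norm z < 1 \<Longrightarrow> Re (deriv f z * cnj (f z) * z) \<ge> 0"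
  shows "starlike_wrt_origin (f ` ball 0 1)"
proof -
  obtain g where g: "g holomorphic_on f ` ball 0 1"
      "\<And>z. z \<in> ball 0 1 \<Longrightarrow> deriv f z * deriv g (f z) = 1"
      "\<And>z. z \<in> ball 0 1 \<Longrightarrow> g (f z) = z"
    using holomorphic_has_inverse[OF f(1) open_ball f(2)] by metis
  have op: "open (f ` ball 0 1)" using f open_mapping_thm3 by blast
  have ray: "of_real t * f z \<in> f ` ball 0 1" if z: "norm z < 1" and t: "0 \<le> t" "t \<le> 1" for z t
  proof (rule ccontr)
    assume out: "of_real t * f z \<notin> f ` ball 0 1"
    define B where "B = {0..1} \<inter> (\<lambda>s::real. of_real s * f z) -` (- f ` ball 0 1)"
    have "closed B"
      unfolding B_def using op by (intro continuous_closed_preimage continuous_intros) auto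
    moreover have "B \<subseteq> {0..1}" by (auto simp: B_def)
    ultimately have "compact B"
      using compact_Int_closed[of "{0..1}" B] by (simp add: inf.absorb2)
    moreover have "t \<in> B" using t out by (simp add: B_def)
    ultimately obtain m where m: "m \<in> B" "\<And>s. s \<in> B \<Longrightarrow> s \<le> m"
      using compact_attains_sup[of B] by blast
    have "m \<noteq> 1" using m(1) z by (auto simp: B_def)
    then have m01: "0 \<le> m" "m < 1" using m(1) by (auto simp: B_def)
    define K where "K = f ` cball 0 (norm z)"
    have KS: "K \<subseteq> f ` ball 0 1" using z by (auto simp: K_def)
    have "continuous_on (cball 0 (norm z)) f"
      using z by (intro holomorphic_on_imp_continuous_on holomorphic_on_subset[OF f(1)]) auto
    then have "closed K"
      unfolding K_def by (intro compact_imp_closed compact_continuous_image) auto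
    define \<phi> where "\<phi> s = (norm (g (of_real s * f z)))\<^sup>2" for s
    have inside: "\<exists>w. norm w < 1 \<and> f w = of_real s * f z" if "m < s" "s \<le> 1" for s
      using that m(2)[of s] m01 by (force simp: B_def)
    have der: "\<exists>y. (\<phi> has_real_derivative y) (at s) \<and> y \<ge> 0" if s: "m < s" "s \<le> 1" for s
    proof -
      obtain w where w: "norm w < 1" "f w = of_real s * f z" using inside[OF s] by blast
      have "(\<phi> has_real_derivative 2 * Re (cnj w * f z / deriv f w)) (at s)"
        unfolding \<phi>_def
        by (rule has_real_derivative_norm_inverse_on_ray[OF f(1) open_ball f(2) g]) (use w in auto)
      moreover have "deriv f w \<noteq> 0" using g(2)[of w] w by auto
      \<comment> \<open>As f w = s * f z, the hypothesis at w carries a factor s, which is positive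
        because s > m >= 0.\<close>
      moreover have "s * Re (deriv f w * cnj (f z) * w) \<ge> 0"
        using nonneg[OF w(1)] unfolding w(2) by (simp add: algebra_simps)
      then have "Re (deriv f w * cnj (f z) * w) \<ge> 0"
        using s m01 by (simp add: zero_le_mult_iff)
      ultimately show ?thesis using Re_mult_cnj_nonneg_iff by force
    qed
    have "of_real s * f z \<in> K" if s: "m < s" "s \<le> 1" for s
    proof -
      obtain w where w: "norm w < 1" "f w = of_real s * f z" using inside[OF s] by blast
      have "\<phi> s \<le> \<phi> 1"
      proof (rule DERIV_nonneg_imp_nondecreasing[OF s(2)])
        show "\<exists>y. (\<phi> has_real_derivative y) (at x) \<and> y \<ge> 0" if "s \<le> x" "x \<le> 1" for x
          using s that by (intro der) auto
      qed
      moreover have "\<phi> s = (norm w)\<^sup>2" "\<phi> 1 = (norm z)\<^sup>2"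
        using g(3)[of w] g(3)[of z] w z by (simp_all add: \<phi>_def)
      ultimately have "norm w \<le> norm z" using power2_le_imp_le[of "norm w" "norm z"] by simp
      then have "f w \<in> K" by (simp add: K_def)
      then show ?thesis by (simp add: w(2))
    qed
    then have "{m<..<1} \<subseteq> (\<lambda>s::real. of_real s * f z) -` K" by auto
    moreover have "closed ((\<lambda>s::real. of_real s * f z) -` K)"
      using \<open>closed K\<close> by (intro continuous_closed_vimage continuous_intros) auto
    ultimately have "closure {m<..<1} \<subseteq> (\<lambda>s::real. of_real s * f z) -` K"
      by (rule closure_minimal)
    then have "of_real m * f z \<in> K" using m01 by (auto simp: subset_iff)
    then show False using m(1) KS by (auto simp: B_def)
  qed
  show ?thesis
    unfolding starlike_wrt_origin_def
    using ray by (auto simp: in_segment scaleR_conv_of_real)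
qed

section \<open>Boundary values of univalent functions\<close>

text \<open>If f z = f 0, then by continuity f (t * z), for t near 1, lies in the open set f (ball 0
  (1/2)) around f 0. But t * z lies outside that half-size disk, against injectivity.\<close>

lemma inj_on_ball_boundary_ne:
  assumes f: "f holomorphic_on ball 0 1" "continuous_on (cball 0 1) f" "inj_on f (ball 0 1)"
    and z: "norm z = 1"
  shows "f z \<noteq> f 0"
proof
  assume eq: "f z = f 0"
  define V where "V = f ` ball 0 (1 / 2)"
  have sub: "ball 0 (1 / 2) \<subseteq> (ball 0 1 :: complex set)" by auto
  have "open V"
    unfolding V_def using f sub
    by (intro open_mapping_thm3 holomorphic_on_subset[OF f(1)] inj_on_subset[OF f(3)]) auto
  moreover have "f z \<in> V" unfolding V_def eq by (rule imageI) simp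
  moreover have t: "\<forall>\<^sub>F t::real in at_left 1. 1 / 2 < t \<and> t < 1"
    by (rule eventually_at_leftI[of "1 / 2"]) auto
  have "((\<lambda>t. of_real t * z) \<longlongrightarrow> of_real 1 * z) (at_left 1)"
    by (intro tendsto_intros)
  then have "((\<lambda>t. f (of_real t * z)) \<longlongrightarrow> f z) (at_left 1)"
    using z by (intro continuous_on_tendsto_compose[OF f(2)] eventually_mono[OF t])
      (auto simp: norm_mult)
  ultimately have "\<forall>\<^sub>F t in at_left 1. f (of_real t * z) \<in> V"
    by (intro topological_tendstoD)
  then obtain t where "1 / 2 < t" "t < 1" "f (of_real t * z) \<in> V"
    using eventually_happens[OF eventually_conj[OF t]] by auto
  moreover from this obtain u where "norm u < 1 / 2" "f (of_real t * z) = f u"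
    by (auto simp: V_def)
  ultimately show False
    using inj_onD[OF f(3), of "of_real t * z" u] z by (auto simp: norm_mult)
qed

lemma deriv_poly: "deriv (poly p) z = poly (pderiv p) z"
  by (rule DERIV_imp_deriv) (rule poly_DERIV)

section \<open>The three equivalent conditions\<close>

theorem theorem2:
  fixes n :: nat and P :: "complex poly"
  assumes "n \<ge> 2"
    and "degree P = n" and "coeff P 0 = 0" and "coeff P 1 = 1"
    and "inj_on (poly P) (ball 0 1)"
    and "critical_points P \<subseteq> sphere 0 1"
  shows "((\<forall>z\<in>ball 0 1. Re (poly (pderiv P) z) > 0) \<longleftrightarrow> (\<forall>k\<in>{2..<n}. coeff P k = 0))
       \<and> ((\<forall>k\<in>{2..<n}. coeff P k = 0) \<longleftrightarrow> starlike_function (poly P))"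
    (is "(?a \<longleftrightarrow> ?b) \<and> (_ \<longleftrightarrow> ?c)")
proof -
  define N where "N = n - 1"
  define p where "p = pderiv P"
  obtain q where Pq: "P = pCons 0 q"
    using assms(3) by (metis coeff_pCons_0 pCons_cases)
  have q: "coeff q k = coeff P (Suc k)" for k by (simp add: Pq)
  have p: "coeff p k = of_nat (Suc k) * coeff q k" for k
    by (simp add: p_def q coeff_pderiv)
  have "N \<ge> 1" using assms(1) by (simp add: N_def)
  have degp: "degree p = N" using assms(2) by (simp add: p_def N_def degree_pderiv)
  have degq: "degree q \<le> N" using assms(1,2) by (auto simp: Pq N_def split: if_splits)
  have q0: "coeff q 0 = 1" using assms(4) by (simp add: q)
  have p0: "coeff p 0 = 1" by (simp add: p q0)
  then have "p \<noteq> 0" by auto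
  have roots: "norm z = 1" if "poly p z = 0" for z
    using assms(6) that by (auto simp: critical_points_def p_def)
  define c where "c = coeff p N"
  have c: "norm c = 1" and self: "p = smult c (conj_reciprocal N p)"
    using self_inversive[OF p0 roots] by (auto simp: c_def degp)
  have c_eq: "c = of_nat n * coeff q N" using assms(1) by (simp add: c_def p N_def)
  have hol: "poly P holomorphic_on ball 0 1" by (intro holomorphic_intros)
  have poly_P: "poly P z = z * poly q z" for z by (simp add: Pq)
  \<comment> \<open>Taking out |z|^2 reduces the starlikeness criterion to the sign condition on
    \<open>p\<close> and \<open>q = P/z\<close>.\<close>
  have Re_eq: "Re (deriv (poly P) z * cnj (poly P z) * z) = (norm z)\<^sup>2 * Re (poly p z * cnj (poly q z))" for z
  proof -
    have "deriv (poly P) z * cnj (poly P z) * z = of_real ((norm z)\<^sup>2) * (poly p z * cnj (poly q z))"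
      unfolding complex_norm_square by (simp add: deriv_poly poly_P p_def mult_ac)
    then show ?thesis by (simp only: Re_of_real_mult)
  qed
  have b_iff: "?b \<longleftrightarrow> (\<forall>k\<in>{1..<N}. coeff q k = 0)"
  proof -
    have "{2..<n} = Suc ` {1..<N}" using assms(1) by (auto simp: N_def image_Suc_atLeastLessThan)
    then show ?thesis by (simp only: q ball_simps)
  qed

  have ab: ?b if ?a
  proof -
    \<comment> \<open>Here 1 + c z^N = l p. Since N >= 1, the constant coefficients give l = 1, so
      the middle coefficients of \<open>p\<close> vanish.\<close>
    have "\<exists>l. 1 + smult c (conj_reciprocal N 1) = smult l p"
      using self_inversive_proportional[of p c 1, unfolded degp] \<open>p \<noteq> 0\<close> self roots that[folded p_def]
      by (auto simp: less_imp_le)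
    then obtain l where l: "1 + smult c (conj_reciprocal N 1) = smult l p" ..
    have l': "coeff (1 + smult c (conj_reciprocal N 1)) k = l * coeff p k" for k
      by (simp add: l)
    have "l = 1" using l'[of 0] \<open>N \<ge> 1\<close> by (simp add: coeff_conj_reciprocal p0)
    show ?b unfolding b_iff
    proof
      fix k assume "k \<in> {1..<N}"
      then have "coeff p k = 0" using l'[of k] \<open>l = 1\<close> by (simp add: coeff_conj_reciprocal)
      then show "coeff q k = 0" unfolding p by (metis mult_eq_0_iff of_nat_eq_0_iff nat.distinct(1))
    qed
  qed

  have tri: "poly q z = 1 + c * z ^ N / of_nat n" "poly p z = 1 + c * z ^ N" if ?b for z
  proof -
    have "q = 1 + monom (coeff q N) N"
    proof (rule poly_eqI)
      fix k
      consider "k = 0" | "k \<in> {1..<N}" | "k = N" | "k > N" by force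
      then show "coeff q k = coeff (1 + monom (coeff q N) N) k"
        using that[unfolded b_iff] q0 \<open>N \<ge> 1\<close> degq by cases (auto simp: coeff_eq_0)
    qed
    then have "poly q z = poly (1 + monom (coeff q N) N) z" by simp
    then show "poly q z = 1 + c * z ^ N / of_nat n"
      using assms(1) by (simp add: poly_monom c_eq)
    have "p = 1 + monom c N"
    proof (rule poly_eqI)
      fix k
      consider "k = 0" | "k \<in> {1..<N}" | "k = N" | "k > N" by force
      moreover have "k \<in> {1..<N} \<Longrightarrow> coeff p k = 0"
        using that[unfolded b_iff] p[of k] by simp
      ultimately show "coeff p k = coeff (1 + monom c N) k"
        using p0 \<open>N \<ge> 1\<close> degp by cases (auto simp: coeff_eq_0 c_def)
    qed
    then have "poly p z = poly (1 + monom c N) z" by simp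
    then show "poly p z = 1 + c * z ^ N" by (simp add: poly_monom)
  qed
  have small: "norm (c * z ^ N) < 1" if "norm z < 1" for z
    using that c \<open>N \<ge> 1\<close> by (simp add: norm_mult norm_power power_less_one_iff)

  have ba: ?a if ?b
  proof
    fix z :: complex assume "z \<in> ball 0 1"
    then have "\<bar>Re (c * z ^ N)\<bar> < 1"
      using small[of z] abs_Re_le_cmod[of "c * z ^ N"] by simp
    then show "Re (poly (pderiv P) z) > 0"
      unfolding p_def[symmetric] tri(2)[OF that] by simp
  qed

  have bc: ?c if ?b
  proof -
    have "Re (poly p z * cnj (poly q z)) \<ge> 0" if z: "norm z < 1" for z
    proof -
      define v where "v = c * z ^ N"
      have v: "norm v < 1" unfolding v_def by (rule small[OF z])
      have "poly p z * cnj (poly q z) = (1 + v) * (1 + cnj v / of_nat n)"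
        using tri[OF \<open>?b\<close>, of z] by (simp add: v_def)
      also have "\<dots> = 1 + v + cnj v / of_nat n + of_real ((norm v)\<^sup>2) / of_nat n"
        unfolding complex_norm_square by (simp add: algebra_simps add_divide_distrib)
      also have "Re \<dots> = 1 + Re v + Re v / n + (norm v)\<^sup>2 / n"
        by (simp add: Re_divide_of_nat)
      finally have "Re (poly p z * cnj (poly q z)) = 1 + Re v + Re v / n + (norm v)\<^sup>2 / n" .
      moreover have "- norm v \<le> Re v" using abs_Re_le_cmod[of v] by linarith
      moreover have "- norm v / n \<le> Re v / n"
        using calculation(2) by (intro divide_right_mono) auto
      \<comment> \<open>Replacing Re v by its lower bound - |v| turns the expression above into this
        product.\<close>
      moreover have "(1 - norm v) * (1 - norm v / n) \<ge> 0"
        using v assms(1) by (intro mult_nonneg_nonneg) (auto simp: field_simps)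
      moreover have "(1 - norm v) * (1 - norm v / n) = 1 - norm v - norm v / n + (norm v)\<^sup>2 / n"
        by (simp add: algebra_simps power2_eq_square diff_divide_distrib)
      ultimately show ?thesis by linarith
    qed
    then have "Re (deriv (poly P) z * cnj (poly P z) * z) \<ge> 0" if "norm z < 1" for z
      unfolding Re_eq using that by (intro mult_nonneg_nonneg) auto
    then have "starlike_wrt_origin (poly P ` ball 0 1)"
      using assms(3) by (intro Re_nonneg_imp_starlike[OF hol assms(5)]) (auto simp: poly_0_coeff_0)
    moreover have "open (poly P ` ball 0 1)"
      using hol assms(5) open_mapping_thm3 by blast
    moreover have "connected (poly P ` ball 0 1)"
      by (intro connected_continuous_image continuous_intros) auto
    moreover have "poly P analytic_on ball 0 1" using hol by (simp add: analytic_on_open)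
    ultimately show ?c using assms(5) by (simp add: starlike_function_def)
  qed

  have cb: ?b if ?c
  proof -
    have star: "starlike_wrt_origin (poly P ` ball 0 1)"
      using that by (simp add: starlike_function_def)
    have "Re (poly p z * cnj (poly q z)) \<ge> 0" if z: "z \<in> ball 0 1" for z
    \<comment> \<open>At 0 the factor |z|^2 in \<open>Re_eq\<close> vanishes and gives no
      information.\<close>
    proof (cases "z = 0")
      case True
      then show ?thesis by (simp add: poly_0_coeff_0 p0 q0)
    next
      case False
      have "Re (deriv (poly P) z * cnj (poly P z) * z) \<ge> 0"
        using z assms(3) by (intro starlike_imp_Re_nonneg[OF hol assms(5) _ star]) (auto simp: poly_0_coeff_0)
      then show ?thesis unfolding Re_eq using False by (auto simp: zero_le_mult_iff)
    qed
    \<comment> \<open>The zeros of \<open>p\<close> lie on the circle, where P z differs from P 0 =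
      0.\<close>
    moreover have "poly q z \<noteq> 0" if "poly p z = 0" for z
    proof -
      have "poly P z \<noteq> poly P 0"
        using inj_on_ball_boundary_ne[OF hol _ assms(5)] roots[OF that] by (simp add: continuous_intros)
      then show ?thesis by (simp add: poly_P)
    qed
    ultimately have "\<exists>l. q + smult c (conj_reciprocal N q) = smult l p"
      using self_inversive_proportional[of p c q, unfolded degp] \<open>p \<noteq> 0\<close> self roots degq by auto
    then obtain l where l: "q + smult c (conj_reciprocal N q) = smult l p" ..
    have l': "coeff q k + c * cnj (coeff q (N - k)) = l * (of_nat (Suc k) * coeff q k)" if "k \<le> N" for k
      using arg_cong[OF l, of "\<lambda>r. coeff r k"] that by (simp add: coeff_conj_reciprocal p)
    have s: "of_nat (Suc k) * coeff q k = of_nat (Suc (N - k)) * (c * cnj (coeff q (N - k)))" if "k \<le> N" for k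
      using arg_cong[OF self, of "\<lambda>r. coeff r k"] that by (simp add: coeff_conj_reciprocal p algebra_simps)
    \<comment> \<open>At k = 0 the relations \<open>l'\<close> and \<open>s\<close> give l = 1 + x
      and (N + 1) x = 1.\<close>
    have l_eq: "of_nat (Suc N) * l = of_nat (N + 2)"
    proof -
      define x where "x = c * cnj (coeff q N)"
      have "l = 1 + x" "of_nat (Suc N) * x = 1"
        using l'[of 0] s[of 0] q0 by (simp_all add: x_def)
      then show ?thesis by (simp add: distrib_left)
    qed
    show ?b unfolding b_iff
    proof
      fix k assume k: "k \<in> {1..<N}"
      define j where "j = N - k"
      have N: "N = k + j" "k \<ge> 1" "j \<ge> 1" using k by (auto simp: j_def)
      define a where "a = coeff q k"
      define b where "b = c * cnj (coeff q j)"
      have 1: "a + b = l * (of_nat (Suc k) * a)" "of_nat (Suc k) * a = of_nat (Suc j) * b"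
        using l'[of k] s[of k] k by (simp_all add: a_def b_def j_def)
      \<comment> \<open>As N + 2 = (j + 1) + (k + 1) and (k + 1) a = (j + 1) b, one has (N + 2) a =
        (j + 1)(a + b). Inserting a + b = l (k + 1) a and the value of l yields (N + 1) a = (j +
        1)(k + 1) a.\<close>
      have "of_nat (N + 2) * of_nat (Suc N) * a = of_nat (Suc N) * (of_nat (Suc j) * a + of_nat (Suc j) * b)"
        unfolding 1(2)[symmetric] by (simp add: N algebra_simps)
      also have "\<dots> = of_nat (Suc N) * of_nat (Suc j) * (a + b)" by (simp only: algebra_simps)
      also have "\<dots> = (of_nat (Suc N) * l) * of_nat (Suc j) * of_nat (Suc k) * a"
        unfolding 1(1) by (simp only: mult_ac)
      also have "\<dots> = of_nat (N + 2) * of_nat (Suc j * Suc k) * a"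
        unfolding l_eq by (simp only: of_nat_mult mult_ac)
      finally have "of_nat (N + 2) * a * of_nat (Suc j * Suc k) = of_nat (N + 2) * a * of_nat (Suc N)"
        by (simp only: mult_ac)
      \<comment> \<open>The two sides differ by j * k, which is positive exactly because k is a
        middle index.\<close>
      moreover have "Suc j * Suc k \<noteq> Suc N" using N by simp
      then have "(of_nat (Suc j * Suc k) :: complex) \<noteq> of_nat (Suc N)" using of_nat_eq_iff by blast
      moreover have "(of_nat (N + 2) :: complex) \<noteq> 0" unfolding of_nat_eq_0_iff by simp
      ultimately show "coeff q k = 0" unfolding a_def by (metis mult_left_cancel mult_eq_0_iff)
    qed
  qed

  show ?thesis using ab ba bc cb by blast
qed

end
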